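(* Let $X$ be a topological space. If the product $X\times D(\omega_1)$ is $\mathbb R$-factorizable, then $X^\omega$ is hereditarily Lindelöf and hereditarily separable.
   Context: All topological spaces are assumed to be Tychonoff (including Hausdorff). $D(\omega_1)$ is the discrete space of cardinality $\omega_1$. A product $X\times Y$ of topological spaces is (multiplicatively) $\mathbb R$-factorizable if for any continuous function $f\colon X\times Y\to\mathbb R$ there exist second-countable spaces $X',Y'$ and continuous maps $g_1\colon X\to X'$, $g_2\colon Y\to Y'$, and $h\colon X'\times Y'\to\mathbb R$ such that $f=h\circ(g_1\times g_2)$. $X^\omega$ carries the product topology. *)

theory Defs
  imports "HOL-Analysis.Analysis"
begin

unbundle cardinal_syntax

definition tychonoff_space :: "'a topology \<Rightarrow> bool" where
  "tychonoff_space X \<longleftrightarrow> completely_regular_space X \<and> Hausdorff_space X"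

definition factors_through ::
  "'a topology \<Rightarrow> 'b topology \<Rightarrow> ('a \<times> 'b \<Rightarrow> real) \<Rightarrow> 'c topology \<Rightarrow> 'd topology \<Rightarrow> bool" where
  "factors_through X Y f X' Y' \<longleftrightarrow>
     (\<exists>g1 g2 h. continuous_map X X' g1 \<and> continuous_map Y Y' g2 \<and>
        continuous_map (prod_topology X' Y') euclideanreal h \<and>
        (\<forall>x \<in> topspace X. \<forall>y \<in> topspace Y. f (x, y) = h (g1 x, g2 y)))"

text \<open>
  HOL cannot quantify existentially over the types of the points of the second-countable
  spaces, so these are taken to be of type \<^typ>\<open>nat set\<close>. This is no restriction:
  a second-countable Hausdorff space has at most continuum many points, hence has
  a homeomorphic copy among the topologies on sets of points of type \<^typ>\<open>nat set\<close>.
  The lemma \<open>R_factorizable_productI\<close> below shows that arbitrary point types give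
  the same notion. All spaces are Tychonoff by convention, including the factor spaces.
\<close>

definition R_factorizable_product :: "'a topology \<Rightarrow> 'b topology \<Rightarrow> bool" where
  "R_factorizable_product X Y \<longleftrightarrow>
     (\<forall>f. continuous_map (prod_topology X Y) euclideanreal f \<longrightarrow>
        (\<exists>(X' :: nat set topology) (Y' :: nat set topology).
           tychonoff_space X' \<and> second_countable X' \<and>
           tychonoff_space Y' \<and> second_countable Y' \<and>
           factors_through X Y f X' Y'))"

lemma second_countable_homeomorphic_nat_set:
  assumes "second_countable X" and "Hausdorff_space X"
  shows "\<exists>Z :: nat set topology. X homeomorphic_space Z"
proof -
  obtain B where B: "countable B" "\<forall>V\<in>B. openin X V"
    and base: "\<forall>U x. openin X U \<and> x \<in> U \<longrightarrow> (\<exists>V\<in>B. x \<in> V \<and> V \<subseteq> U)"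
    using assms(1) unfolding second_countable_def by (elim exE conjE)
  define c where "c x = to_nat_on B ` {V \<in> B. x \<in> V}" for x
  have inj: "inj_on c (topspace X)"
  proof (rule inj_onI, rule ccontr)
    fix x y assume xy: "x \<in> topspace X" "y \<in> topspace X" "c x = c y" "x \<noteq> y"
    obtain U W where UW: "openin X U" "x \<in> U" "openin X W" "y \<in> W" "disjnt U W"
      using assms(2) xy(1,2,4) unfolding Hausdorff_space_def by metis
    obtain V where V: "V \<in> B" "x \<in> V" "V \<subseteq> U"
      using base UW(1,2) by metis
    have "to_nat_on B V \<in> c y"
      using V xy(3) unfolding c_def by blast
    then obtain V' where "V' \<in> B" "y \<in> V'" "to_nat_on B V' = to_nat_on B V"
      unfolding c_def by auto
    then have "y \<in> V"
      using V(1) B(1) by simp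
    then show False
      using V UW by (auto simp: disjnt_def)
  qed
  define d where "d = inv_into (topspace X) c"
  have dc: "d (c x) = x" if "x \<in> topspace X" for x
    using inj that by (simp add: d_def)
  define Z where "Z = pullback_topology (c ` topspace X) d X"
  have top: "topspace Z = c ` topspace X"
    unfolding Z_def topspace_pullback_topology using dc by auto
  have "continuous_map Z X d"
    unfolding continuous_map_def top
  proof (intro conjI allI impI)
    show "d \<in> c ` topspace X \<rightarrow> topspace X"
      using dc by auto
    fix U assume "openin X U"
    then show "openin Z {x \<in> c ` topspace X. d x \<in> U}"
      unfolding Z_def openin_pullback_topology by (intro exI[of _ U]) auto
  qed
  moreover have "continuous_map X Z c"
    unfolding continuous_map_def top
  proof (intro conjI allI impI)
    show "c \<in> topspace X \<rightarrow> c ` topspace X"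
      by auto
    fix S assume "openin Z S"
    then obtain U where U: "openin X U" "S = d -` U \<inter> c ` topspace X"
      unfolding Z_def openin_pullback_topology by (elim exE conjE)
    then have "{x \<in> topspace X. c x \<in> S} = U"
      using dc openin_subset[OF U(1)] by (auto simp: subset_iff)
    then show "openin X {x \<in> topspace X. c x \<in> S}"
      using U by simp
  qed
  ultimately have "homeomorphic_maps X Z c d"
    unfolding homeomorphic_maps_def top using dc by auto
  then show ?thesis
    unfolding homeomorphic_space_def by blast
qed

lemma factors_through_homeomorphic:
  assumes "factors_through X Y f X' Y'"
    and "X' homeomorphic_space X''" and "Y' homeomorphic_space Y''"
  shows "factors_through X Y f X'' Y''"
proof -
  obtain g1 g2 h where g: "continuous_map X X' g1" "continuous_map Y Y' g2"
    and h: "continuous_map (prod_topology X' Y') euclideanreal h"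
    and f: "\<And>x y. x \<in> topspace X \<Longrightarrow> y \<in> topspace Y \<Longrightarrow> f (x, y) = h (g1 x, g2 y)"
    using assms(1) unfolding factors_through_def by blast
  obtain a a' where a: "continuous_map X' X'' a" "continuous_map X'' X' a'"
      "\<And>x. x \<in> topspace X' \<Longrightarrow> a' (a x) = x"
    using assms(2) unfolding homeomorphic_space_def homeomorphic_maps_def by blast
  obtain b b' where b: "continuous_map Y' Y'' b" "continuous_map Y'' Y' b'"
      "\<And>y. y \<in> topspace Y' \<Longrightarrow> b' (b y) = y"
    using assms(3) unfolding homeomorphic_space_def homeomorphic_maps_def by blast
  have "continuous_map (prod_topology X'' Y'') (prod_topology X' Y') (\<lambda>(x, y). (a' x, b' y))"
    using a(2) b(2) by (simp add: continuous_map_prod_top)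
  then have "continuous_map (prod_topology X'' Y'') euclideanreal (h \<circ> (\<lambda>(x, y). (a' x, b' y)))"
    using h continuous_map_compose by blast
  moreover have "continuous_map X X'' (a \<circ> g1)" "continuous_map Y Y'' (b \<circ> g2)"
    using g a(1) b(1) continuous_map_compose by blast+
  moreover have "g1 x \<in> topspace X'" if "x \<in> topspace X" for x
    using g(1) that by (auto simp: continuous_map_def)
  moreover have "g2 y \<in> topspace Y'" if "y \<in> topspace Y" for y
    using g(2) that by (auto simp: continuous_map_def)
  ultimately show ?thesis
    unfolding factors_through_def using f a(3) b(3)
    by (intro exI[of _ "a \<circ> g1"] exI[of _ "b \<circ> g2"]
          exI[of _ "h \<circ> (\<lambda>(x, y). (a' x, b' y))"]) auto
qed

lemma R_factorizable_productI:
  assumes "\<And>f. continuous_map (prod_topology X Y) euclideanreal f \<Longrightarrow>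
     \<exists>(X' :: 'c topology) (Y' :: 'd topology).
       tychonoff_space X' \<and> second_countable X' \<and>
       tychonoff_space Y' \<and> second_countable Y' \<and>
       factors_through X Y f X' Y'"
  shows "R_factorizable_product X Y"
  unfolding R_factorizable_product_def
proof (intro allI impI)
  fix f assume "continuous_map (prod_topology X Y) euclideanreal f"
  then obtain X' :: "'c topology" and Y' :: "'d topology"
    where X': "tychonoff_space X'" "second_countable X'"
      and Y': "tychonoff_space Y'" "second_countable Y'"
      and f: "factors_through X Y f X' Y'"
    using assms by blast
  obtain X'' :: "nat set topology" where X'': "X' homeomorphic_space X''"
    using second_countable_homeomorphic_nat_set[of X'] X' unfolding tychonoff_space_def by blast
  obtain Y'' :: "nat set topology" where Y'': "Y' homeomorphic_space Y''"
    using second_countable_homeomorphic_nat_set[of Y'] Y' unfolding tychonoff_space_def by blast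
  have "tychonoff_space X''" "tychonoff_space Y''"
    using X'(1) Y'(1) homeomorphic_completely_regular_space[OF X''] homeomorphic_Hausdorff_space[OF X'']
      homeomorphic_completely_regular_space[OF Y''] homeomorphic_Hausdorff_space[OF Y'']
    by (simp_all add: tychonoff_space_def)
  moreover have "second_countable X''" "second_countable Y''"
    using X'(2) Y'(2) homeomorphic_space_second_countability[OF X'']
      homeomorphic_space_second_countability[OF Y''] by simp_all
  moreover have "factors_through X Y f X'' Y''"
    using factors_through_homeomorphic[OF f X'' Y''] .
  ultimately show "\<exists>(X' :: nat set topology) (Y' :: nat set topology).
       tychonoff_space X' \<and> second_countable X' \<and>
       tychonoff_space Y' \<and> second_countable Y' \<and>
       factors_through X Y f X' Y'"
    by blast
qed

end

theory Submission
  imports Defs "HOL-Library.Countable_Set_Type"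
begin

text \<open>
  A family of continuous functions on \<open>X\<close> indexed by \<open>D\<close> is a single continuous function on
  \<open>X \<times> D\<close>, so by \<open>\<real>\<close>-factorizability the whole family factors through one continuous map of
  \<open>X\<close> into a second-countable space. If \<open>X\<^sup>\<omega>\<close> failed to be hereditarily Lindelof or hereditarily
  separable, it would contain a right- or left-separated family of type \<open>\<omega>\<^sub>1\<close>. The separating
  neighbourhoods can be taken basic open and are then described by \<open>\<omega>\<^sub>1\<close> many continuous functions
  on \<open>X\<close>, so the family stays separated in a countable power of a second-countable space, which is
  impossible.
\<close>

section \<open>Factorization of families over a discrete factor\<close>

lemma continuous_map_prod_discrete_topology:
  assumes "\<And>d. d \<in> D \<Longrightarrow> continuous_map X Z (\<lambda>x. f (x, d))"
  shows "continuous_map (prod_topology X (discrete_topology D)) Z f"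
  unfolding continuous_map_def
proof (intro conjI allI impI)
  show "f \<in> topspace (prod_topology X (discrete_topology D)) \<rightarrow> topspace Z"
    using assms by (force simp: continuous_map_def)
  fix T assume T: "openin Z T"
  have "{p \<in> topspace (prod_topology X (discrete_topology D)). f p \<in> T} =
      (\<Union>d\<in>D. {x \<in> topspace X. f (x, d) \<in> T} \<times> {d})"
    by auto
  moreover have "openin X {x \<in> topspace X. f (x, d) \<in> T}" if "d \<in> D" for d
    using assms[OF that] T by (simp add: continuous_map_def)
  ultimately show "openin (prod_topology X (discrete_topology D))
      {p \<in> topspace (prod_topology X (discrete_topology D)). f p \<in> T}"
    by (auto simp: openin_prod_Times_iff)
qed

text \<open>The gain is that \<open>g\<close> is the same for all \<open>d\<close>. The index
  survives only in \<open>k d\<close>, the section of the outer function \<open>h\<close> at the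
  point \<open>g2 d\<close>.\<close>

lemma R_factorizable_discrete_family:
  assumes "R_factorizable_product X (discrete_topology D)"
    and "\<And>d. d \<in> D \<Longrightarrow> continuous_map X euclideanreal (f d)"
  obtains X' :: "nat set topology" and g k where
    "second_countable X'" "continuous_map X X' g"
    "\<And>d. d \<in> D \<Longrightarrow> continuous_map X' euclideanreal (k d)"
    "\<And>d x. d \<in> D \<Longrightarrow> x \<in> topspace X \<Longrightarrow> f d x = k d (g x)"
proof -
  have "continuous_map (prod_topology X (discrete_topology D)) euclideanreal (\<lambda>(x, d). f d x)"
    using assms(2) by (intro continuous_map_prod_discrete_topology) simp
  then obtain X' Y' :: "nat set topology" where X': "second_countable X'"
    and "factors_through X (discrete_topology D) (\<lambda>(x, d). f d x) X' Y'"
    using assms(1) unfolding R_factorizable_product_def by blast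
  then obtain g1 g2 h where g: "continuous_map X X' g1" "g2 \<in> D \<rightarrow> topspace Y'"
    and h: "continuous_map (prod_topology X' Y') euclideanreal h"
    and f: "\<And>x d. x \<in> topspace X \<Longrightarrow> d \<in> D \<Longrightarrow> f d x = h (g1 x, g2 d)"
    unfolding factors_through_def by auto
  have "continuous_map X' euclideanreal (\<lambda>z. h (z, g2 d))" if "d \<in> D" for d
  proof -
    have "continuous_map X' (prod_topology X' Y') (\<lambda>z. (z, g2 d))"
      using g(2) that by (auto simp: continuous_map_pairwise o_def)
    from continuous_map_compose[OF this h] show ?thesis
      by (simp add: o_def)
  qed
  then show thesis
    using that[of X' g1 "\<lambda>d z. h (z, g2 d)"] X' g(1) f by blast
qed

text \<open>Each \<open>U d\<close> contains a box around \<open>x d\<close> with finite support,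
  and the box can be coded by a finite word over a countable base. Uncountably many indices cannot
  have distinct codes, and two points with equal codes lie in each other's boxes. The symmetric
  conclusion refutes right and left separation alike.\<close>

lemma R_factorizable_mutual_membership:
  fixes X :: "'a topology" and D :: "'b set"
  assumes "completely_regular_space X" "uncountable D"
    and "R_factorizable_product X (discrete_topology D)"
    and U: "\<And>d. d \<in> D \<Longrightarrow> openin (product_topology (\<lambda>n::nat. X) UNIV) (U d)"
    and x: "\<And>d. d \<in> D \<Longrightarrow> x d \<in> U d"
  obtains d e where "d \<in> D" "e \<in> D" "d \<noteq> e" "x d \<in> U e" "x e \<in> U d"
proof -
  have "\<forall>d\<in>D. \<exists>V. finite {i. V i \<noteq> topspace X} \<and> (\<forall>i. openin X (V i)) \<and>
      (\<forall>i. x d i \<in> V i) \<and> Pi\<^sub>E UNIV V \<subseteq> U d"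
  proof
    fix d assume "d \<in> D"
    obtain V where "finite {i \<in> UNIV. V i \<noteq> topspace X}" "\<forall>i\<in>UNIV. openin X (V i)"
        "x d \<in> Pi\<^sub>E UNIV V" "Pi\<^sub>E UNIV V \<subseteq> U d"
      using U[OF \<open>d \<in> D\<close>, unfolded openin_product_topology_alt] x[OF \<open>d \<in> D\<close>] by meson
    then show "\<exists>V. finite {i. V i \<noteq> topspace X} \<and> (\<forall>i. openin X (V i)) \<and>
        (\<forall>i. x d i \<in> V i) \<and> Pi\<^sub>E UNIV V \<subseteq> U d"
      by (intro exI[of _ V]) (auto simp: PiE_UNIV_domain)
  qed
  from bchoice[OF this] obtain V where "\<forall>d\<in>D. finite {i. V d i \<noteq> topspace X} \<and>
      (\<forall>i. openin X (V d i)) \<and> (\<forall>i. x d i \<in> V d i) \<and> Pi\<^sub>E UNIV (V d) \<subseteq> U d" ..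
  then have V: "finite {i. V d i \<noteq> topspace X}" "openin X (V d i)" "x d i \<in> V d i"
      "Pi\<^sub>E UNIV (V d) \<subseteq> U d" if "d \<in> D" for d i
    using that by simp_all
  have xtop: "x d i \<in> topspace X" if "d \<in> D" for d i
    using V(2,3)[OF that] openin_subset by blast
  \<comment> \<open>From coordinate \<open>n d\<close> on the box imposes no condition, so only an
    initial segment of coordinates has to be coded.\<close>
  have "\<exists>n. \<forall>i\<ge>n. V d i = topspace X" if d: "d \<in> D" for d
  proof -
    obtain n where "{i. V d i \<noteq> topspace X} \<subseteq> {..<n}"
      using V(1)[OF d] finite_nat_iff_bounded by blast
    then show ?thesis
      by (intro exI[of _ n]) force
  qed
  then obtain n where n: "\<And>d i. d \<in> D \<Longrightarrow> n d \<le> i \<Longrightarrow> V d i = topspace X"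
    by metis
  \<comment> \<open>Complete regularity turns each side of a box into a function:
    \<open>V d i\<close> contains the set where \<open>f (d, i) < 1\<close>, which contains
    \<open>x d i\<close>.\<close>
  have "\<forall>p\<in>D \<times> UNIV. \<exists>f. continuous_map X euclideanreal f \<and>
      f (x (fst p) (snd p)) = 0 \<and> f ` (topspace X - V (fst p) (snd p)) \<subseteq> {1}"
    using assms(1)[unfolded completely_regular_space_alt'] V(2,3) by (metis mem_Times_iff)
  from bchoice[OF this] obtain f where
      "\<forall>p\<in>D \<times> UNIV. continuous_map X euclideanreal (f p) \<and>
        f p (x (fst p) (snd p)) = 0 \<and> f p ` (topspace X - V (fst p) (snd p)) \<subseteq> {1}" ..
  then have f: "continuous_map X euclideanreal (f (d, i))" "f (d, i) (x d i) = 0"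
      "y \<in> topspace X \<Longrightarrow> y \<notin> V d i \<Longrightarrow> f (d, i) y = 1" if "d \<in> D" for d i y
    using that by (auto simp: image_subset_iff)
  \<comment> \<open>The functions are indexed by \<open>D \<times> UNIV\<close>, but factorizability
    concerns families over \<open>D\<close>. Since \<open>D\<close> is infinite, both index sets
    have the same cardinality, and \<open>\<phi>\<close> reindexes the family.\<close>
  have "infinite D"
    using assms(2) uncountable_infinite by blast
  then have "|D \<times> (UNIV :: nat set)| =o |D|"
    by (intro card_of_Times_infinite_simps(1)) (auto simp: infinite_iff_card_of_nat)
  then obtain \<phi> where \<phi>: "bij_betw \<phi> (D \<times> (UNIV :: nat set)) D"
    using card_of_ordIso by blast
  define \<psi> where "\<psi> = inv_into (D \<times> (UNIV :: nat set)) \<phi>"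
  have \<phi>D: "\<phi> (d, i) \<in> D" and \<psi>\<phi>: "\<psi> (\<phi> (d, i)) = (d, i)" if "d \<in> D" for d i
    using \<phi> that by (auto simp: \<psi>_def bij_betw_def)
  have \<psi>D: "fst (\<psi> c) \<in> D" if "c \<in> D" for c
    using \<phi> that unfolding \<psi>_def by (metis bij_betw_def inv_into_into mem_Times_iff)
  have f\<psi>: "continuous_map X euclideanreal (f (\<psi> c))" if "c \<in> D" for c
    using f(1)[OF \<psi>D[OF that], of "snd (\<psi> c)"] by simp
  obtain X' :: "nat set topology" and g k where X': "second_countable X'"
    and g: "continuous_map X X' g"
    and k: "\<And>c. c \<in> D \<Longrightarrow> continuous_map X' euclideanreal (k c)"
      "\<And>c y. c \<in> D \<Longrightarrow> y \<in> topspace X \<Longrightarrow> f (\<psi> c) y = k c (g y)"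
    by (rule R_factorizable_discrete_family[OF assms(3) f\<psi>]) (assumption, rule that)
  obtain B where B: "countable B"
    and base: "\<forall>W z. openin X' W \<and> z \<in> W \<longrightarrow> (\<exists>N\<in>B. z \<in> N \<and> N \<subseteq> W)"
    using X' unfolding second_countable_def by (elim exE conjE)
  have gtop: "g y \<in> topspace X'" if "y \<in> topspace X" for y
    using g that by (auto simp: continuous_map_def)
  \<comment> \<open>The condition \<open>f (d, i) < 1\<close> is read off in \<open>X'\<close> as
    the open set \<open>W\<close>, which can be shrunk to a base element around
    \<open>g (x d i)\<close>.\<close>
  have "\<exists>N\<in>B. g (x d i) \<in> N \<and> (\<forall>y\<in>topspace X. g y \<in> N \<longrightarrow> y \<in> V d i)"
    if "d \<in> D" for d i
  proof -
    define W where "W = {z \<in> topspace X'. k (\<phi> (d, i)) z \<in> {..<1}}"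
    have eq: "k (\<phi> (d, i)) (g y) = f (d, i) y" if "y \<in> topspace X" for y
      using k(2)[OF \<phi>D[OF \<open>d \<in> D\<close>] that] \<psi>\<phi>[OF \<open>d \<in> D\<close>] by simp
    have "openin X' W"
      unfolding W_def using k(1)[OF \<phi>D[OF that]]
      by (rule openin_continuous_map_preimage) simp
    moreover have "g (x d i) \<in> W"
      using f(2)[OF that] eq[OF xtop[OF that]] gtop[OF xtop[OF that]] by (simp add: W_def)
    ultimately obtain N where N: "N \<in> B" "g (x d i) \<in> N" "N \<subseteq> W"
      using base by metis
    have "y \<in> V d i" if "y \<in> topspace X" "g y \<in> N" for y
    proof -
      have "g y \<in> W"
        using that(2) N(3) by blast
      then have "f (d, i) y < 1"
        using eq[OF that(1)] by (simp add: W_def)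
      then show ?thesis
        using f(3)[OF \<open>d \<in> D\<close> that(1), of i] by force
    qed
    with N show ?thesis
      by blast
  qed
  then obtain N where N: "\<And>d i. d \<in> D \<Longrightarrow> N d i \<in> B" "\<And>d i. d \<in> D \<Longrightarrow> g (x d i) \<in> N d i"
      "\<And>d i y. d \<in> D \<Longrightarrow> y \<in> topspace X \<Longrightarrow> g y \<in> N d i \<Longrightarrow> y \<in> V d i"
    by metis
  \<comment> \<open>The code records \<open>n d\<close> through its length. As a finite list over
    the countable \<open>B\<close>, it takes only countably many values.\<close>
  define c where "c d = map (N d) [0..<n d]" for d
  have "c ` D \<subseteq> lists B"
    using N(1) by (auto simp: c_def)
  then have "countable (c ` D)"
    using countable_lists[OF B] countable_subset by blast
  then have "\<not> inj_on c D"
    using assms(2) countable_image_inj_on by blast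
  then obtain d e where de: "d \<in> D" "e \<in> D" "d \<noteq> e" "c d = c e"
    unfolding inj_on_def by blast
  \<comment> \<open>Below \<open>n d\<close>, \<open>g (x e i)\<close> lies in
    \<open>N e i = N d i\<close>, which forces \<open>x e i\<close> into \<open>V d i\<close>; from
    \<open>n d\<close> on, \<open>V d i\<close> is the whole space. The roles of \<open>d\<close>
    and \<open>e\<close> are later exchanged.\<close>
  have mem: "x e \<in> U d" if "d \<in> D" "e \<in> D" "c d = c e" for d e
  proof -
    have "x e i \<in> V d i" for i
    proof (cases "i < n d")
      case True
      have "n d = n e"
        using arg_cong[OF that(3), of length] by (simp add: c_def)
      then have "N d i = N e i"
        using that(3) True by (simp add: c_def)
      then show ?thesis
        using N(2)[OF that(2), of i] N(3)[OF that(1) xtop[OF that(2)]] by simp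
    next
      case False
      then show ?thesis
        using n[OF that(1)] xtop[OF that(2)] by simp
    qed
    then show ?thesis
      using V(4)[OF that(1)] by (auto simp: PiE_UNIV_domain)
  qed
  show thesis
    using that[of d e] de mem by metis
qed

section \<open>Separated families of length \<omega>_1\<close>

lemma omega1_wellorder:
  assumes "|D| =o cardSuc natLeq"
  obtains R where "wf R" "total_on D R" "\<And>d. countable {e. (e, d) \<in> R}"
    "uncountable D"
proof
  show "wf ( |D| - Id)"
    using card_of_Well_order[of D] well_order_on_def by blast
  show "total_on D ( |D| - Id)"
    using card_of_well_order_on[of D] by (auto simp: well_order_on_def linear_order_on_def total_on_def)
  show "uncountable D"
  proof
    assume "countable D"
    then have "|D| \<le>o natLeq"
      by (simp add: countable_card_le_natLeq)
    with assms cardSuc_greater[OF natLeq_Card_order] show False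
      using not_ordLess_ordLeq ordIso_symmetric ordIso_ordLeq_trans by blast
  qed
  show "countable {e. (e, d) \<in> |D| - Id}" for d
  proof (cases "d \<in> D")
    case True
    \<comment> \<open>A proper initial segment of a cardinal order has smaller cardinality, and
      below the successor of \<open>natLeq\<close> this means countable.\<close>
    have "|underS ( |D| ) d| <o |D|"
      using card_of_underS[OF card_of_Card_order] True by (simp add: Field_card_of)
    then have "|underS ( |D| ) d| <o cardSuc natLeq"
      using assms ordLess_ordIso_trans by blast
    then have "countable (underS ( |D| ) d)"
      unfolding countable_card_le_natLeq
      using cardSuc_ordLeq_ordLess[OF natLeq_Card_order card_of_Card_order] by blast
    moreover have "{e. (e, d) \<in> |D| - Id} \<subseteq> underS ( |D| ) d"
      by (auto simp: underS_def)
    ultimately show ?thesis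
      by (rule countable_subset[rotated])
  next
    \<comment> \<open>Such a \<open>d\<close> has no predecessors. Countability is stated for every
      \<open>d\<close> because the recursions below run over the whole index type.\<close>
    case False
    then have "{e. (e, d) \<in> |D| - Id} = {}"
      using Field_card_of[of D] by (auto simp: Field_def)
    then show ?thesis
      by (simp only: countable_empty)
  qed
qed

text \<open>Recursion along \<open>R\<close>: before stage \<open>d\<close> only countably many
  members of a cover without countable subcover have been used, so a point \<open>x d\<close> is
  left uncovered.\<close>

lemma not_Lindelof_right_separated:
  assumes "\<not> Lindelof_space (subtopology Z S)" "wf R" "\<And>d. countable {e. (e, d) \<in> R}"
  obtains x U where "\<And>d. openin Z (U d)" "\<And>d. x d \<in> U d"
    "\<And>d e. (e, d) \<in> R \<Longrightarrow> x d \<notin> U e"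
proof -
  obtain \<U> where \<U>: "\<And>U. U \<in> \<U> \<Longrightarrow> openin Z U" "topspace Z \<inter> S \<subseteq> \<Union>\<U>"
    and no: "\<And>\<V>. countable \<V> \<Longrightarrow> \<V> \<subseteq> \<U> \<Longrightarrow> \<not> topspace Z \<inter> S \<subseteq> \<Union>\<V>"
  proof -
    obtain \<C> where \<C>: "\<And>C. C \<in> \<C> \<Longrightarrow> openin (subtopology Z S) C"
        "topspace Z \<inter> S \<subseteq> \<Union>\<C>"
        and no: "\<And>\<V>. countable \<V> \<Longrightarrow> \<V> \<subseteq> \<C> \<Longrightarrow> \<not> topspace Z \<inter> S \<subseteq> \<Union>\<V>"
      using assms(1) unfolding Lindelof_space_alt topspace_subtopology by metis
    show thesis
    proof
      \<comment> \<open>The cover of the subspace is lifted to open sets of \<open>Z\<close>; taking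
        traces on \<open>S\<close> carries a countable subcover back.\<close>
      let ?\<U> = "{U. openin Z U \<and> U \<inter> S \<in> \<C>}"
      show "openin Z U" if "U \<in> ?\<U>" for U
        using that by simp
      show "topspace Z \<inter> S \<subseteq> \<Union>?\<U>"
      proof
        fix z assume "z \<in> topspace Z \<inter> S"
        then obtain C where "C \<in> \<C>" "z \<in> C"
          using \<C>(2) by blast
        then show "z \<in> \<Union>?\<U>"
          using \<C>(1)[of C] by (auto simp: openin_subtopology)
      qed
      fix \<V> assume "countable \<V>" "\<V> \<subseteq> ?\<U>"
      then have "\<not> topspace Z \<inter> S \<subseteq> \<Union>((\<lambda>U. U \<inter> S) ` \<V>)"
        by (intro no) auto
      then show "\<not> topspace Z \<inter> S \<subseteq> \<Union>\<V>"
        by blast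
    qed
  qed
  have "\<forall>z\<in>topspace Z \<inter> S. \<exists>U. z \<in> U \<and> U \<in> \<U>"
    using \<U>(2) by blast
  from bchoice[OF this] obtain u where u: "\<forall>z\<in>topspace Z \<inter> S. z \<in> u z \<and> u z \<in> \<U>" ..
  have "\<exists>x. \<forall>d. x d \<in> topspace Z \<inter> S - (\<Union>e\<in>{e. (e, d) \<in> R}. u (x e))"
  proof (rule dependent_wf_choice[OF assms(2)])
    show "\<exists>r. r \<in> topspace Z \<inter> S - (\<Union>e\<in>{e. (e, d) \<in> R}. u (x e))"
      if "\<And>y. (y, d) \<in> R \<Longrightarrow> x y \<in> topspace Z \<inter> S - (\<Union>e\<in>{e. (e, y) \<in> R}. u (x e))" for d x
    proof -
      have "\<not> topspace Z \<inter> S \<subseteq> (\<Union>e\<in>{e. (e, d) \<in> R}. u (x e))"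
        using that u by (intro no countable_image assms(3) image_subsetI) simp
      then show ?thesis
        by blast
    qed
  qed simp
  then obtain x where x: "\<And>d. x d \<in> topspace Z \<inter> S - (\<Union>e\<in>{e. (e, d) \<in> R}. u (x e))"
    by blast
  show thesis
    by (rule that[of "\<lambda>d. u (x d)" x]) (use x u \<U> in blast)+
qed

text \<open>Dual recursion: the earlier points form a countable, hence non-dense, set, so
  \<open>x d\<close> can be chosen outside their closure, and \<open>U d\<close> is the complement
  of that closure.\<close>

lemma not_separable_left_separated:
  assumes "\<not> separable_space (subtopology Z S)" "wf R" "\<And>d. countable {e. (e, d) \<in> R}"
  obtains x U where "\<And>d. openin Z (U d)" "\<And>d. x d \<in> U d"
    "\<And>d e. (e, d) \<in> R \<Longrightarrow> x e \<notin> U d"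
proof -
  have no: "\<exists>z. z \<in> topspace Z \<inter> S - Z closure_of C" if "countable C" "C \<subseteq> topspace Z \<inter> S" for C
  proof (rule ccontr)
    assume "\<not> ?thesis"
    then have "subtopology Z S closure_of C = topspace (subtopology Z S)"
      using that(2) closure_of_subset_topspace[of Z C] by (auto simp: closure_of_subtopology Int_absorb1)
    then show False
      using assms(1) that unfolding separable_space_def topspace_subtopology by blast
  qed
  have "\<exists>x. \<forall>d. x d \<in> topspace Z \<inter> S - Z closure_of (x ` {e. (e, d) \<in> R})"
  proof (rule dependent_wf_choice[OF assms(2)])
    show "\<exists>r. r \<in> topspace Z \<inter> S - Z closure_of (x ` {e. (e, d) \<in> R})"
      if "\<And>y. (y, d) \<in> R \<Longrightarrow> x y \<in> topspace Z \<inter> S - Z closure_of (x ` {e. (e, y) \<in> R})" for d x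
      using that by (intro no countable_image assms(3)) auto
    \<comment> \<open>Well-founded choice requires that the condition at \<open>d\<close> depend
      only on the values at predecessors of \<open>d\<close>.\<close>
    show "(r \<in> topspace Z \<inter> S - Z closure_of (f ` {e. (e, d) \<in> R})) \<longleftrightarrow>
          (r \<in> topspace Z \<inter> S - Z closure_of (g ` {e. (e, d) \<in> R}))"
      if "\<And>z. (z, d) \<in> R \<Longrightarrow> f z = g z" for f g d r
      using that by (metis (no_types, lifting) image_cong mem_Collect_eq)
  qed
  then obtain x where x: "\<And>d. x d \<in> topspace Z \<inter> S - Z closure_of (x ` {e. (e, d) \<in> R})"
    by blast
  show thesis
  proof (rule that[of "\<lambda>d. topspace Z - Z closure_of (x ` {e. (e, d) \<in> R})" x])
    show "openin Z (topspace Z - Z closure_of (x ` {e. (e, d) \<in> R}))" for d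
      by (simp add: openin_diff)
    show "x d \<in> topspace Z - Z closure_of (x ` {e. (e, d) \<in> R})" for d
      using x by blast
    show "x e \<notin> topspace Z - Z closure_of (x ` {e. (e, d) \<in> R})" if "(e, d) \<in> R" for d e
      using closure_of_subset_Int[of Z "x ` {e. (e, d) \<in> R}"] that by blast
  qed
qed

theorem proposition2p6:
  fixes X :: "'a topology" and D :: "'b set"
  assumes "tychonoff_space X"
    and "|D| =o cardSuc natLeq"
    and "R_factorizable_product X (discrete_topology D)"
  shows "hereditarily Lindelof_space (product_topology (\<lambda>n::nat. X) UNIV)
    \<and> hereditarily separable_space (product_topology (\<lambda>n::nat. X) UNIV)"
proof -
  obtain R where R: "wf R" "total_on D R" "\<And>d. countable {e. (e, d) \<in> R}" and D: "uncountable D"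
    using omega1_wellorder[OF assms(2)] by metis
  have X: "completely_regular_space X"
    using assms(1) by (simp add: tychonoff_space_def)
  let ?Z = "product_topology (\<lambda>n::nat. X) UNIV"
  have "Lindelof_space (subtopology ?Z S)" for S
  proof (rule ccontr)
    assume "\<not> ?thesis"
    then obtain x :: "'b \<Rightarrow> nat \<Rightarrow> 'a" and U where
      *: "\<And>d. openin ?Z (U d)" "\<And>d. x d \<in> U d" "\<And>d e. (e, d) \<in> R \<Longrightarrow> x d \<notin> U e"
      using not_Lindelof_right_separated[OF _ R(1,3)] by metis
    obtain d e where "d \<in> D" "e \<in> D" "d \<noteq> e" "x d \<in> U e" "x e \<in> U d"
      by (rule R_factorizable_mutual_membership[OF X D assms(3), of U x]) (use * in auto)
    \<comment> \<open>By totality \<open>d\<close> and \<open>e\<close> are comparable, and the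
      neighbourhood of the earlier index misses the later point.\<close>
    then show False
      using *(3) R(2) unfolding total_on_def by metis
  qed
  moreover have "separable_space (subtopology ?Z S)" for S
  proof (rule ccontr)
    assume "\<not> ?thesis"
    then obtain x :: "'b \<Rightarrow> nat \<Rightarrow> 'a" and U where
      *: "\<And>d. openin ?Z (U d)" "\<And>d. x d \<in> U d" "\<And>d e. (e, d) \<in> R \<Longrightarrow> x e \<notin> U d"
      using not_separable_left_separated[OF _ R(1,3)] by metis
    obtain d e where "d \<in> D" "e \<in> D" "d \<noteq> e" "x d \<in> U e" "x e \<in> U d"
      by (rule R_factorizable_mutual_membership[OF X D assms(3), of U x]) (use * in auto)
    \<comment> \<open>Here the neighbourhood of the later index misses the earlier point.\<close>
    then show False
      using *(3) R(2) unfolding total_on_def by metis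
  qed
  ultimately show ?thesis
    by (simp add: hereditarily)
qed

end
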